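(* Let $p,q>1$ and $r\in(0,1)$, and set $r'=(1-r^q)^{1/q}$. Then $$\frac{d}{dr}K_{p,q}(r)=\frac{1}{r\,(r')^q}\left(E_{p,q}(r)-(r')^qK_{p,q}(r)\right),$$ $$\frac{d}{dr}E_{p,q}(r)=\frac{q}{pr}\left(E_{p,q}(r)-K_{p,q}(r)\right),$$ $$\frac{d^2}{dr^2}K_{p,q}(r)=\frac{1}{r^2(r')^{2q}}\left[\left(\frac{q(r')^q}{p}+qr^q-2(r')^q\right)E_{p,q}(r)+\left(2(r')^{2q}-\frac{q}{p}(r')^q\right)K_{p,q}(r)\right],$$ $$\frac{d^2}{dr^2}E_{p,q}(r)=\frac{q}{pr^2}\left(\left(\frac{q}{p}-\frac{1}{(r')^q}-1\right)E_{p,q}(r)+\left(2-\frac{q}{p}\right)K_{p,q}(r)\right).$$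
   Context: For $p,q>1$ and $r\in(0,1)$, the generalized complete $(p,q)$-elliptic integrals of the first and second kind are $$K_{p,q}(r)=\int_0^1\frac{dt}{(1-t^q)^{1/p}(1-r^qt^q)^{1-1/p}},\qquad E_{p,q}(r)=\int_0^1\left(\frac{1-r^qt^q}{1-t^q}\right)^{1/p}dt.$$ *)

theory Defs
  imports "HOL-Analysis.Analysis"
begin

(* The integrands are unbounded at t = 1.  The Henstock-Kurzweil integral covers such improper
   integrals directly, and the value of the integrand at the single point t = 1 is irrelevant. *)

definition ellipticK :: "real \<Rightarrow> real \<Rightarrow> real \<Rightarrow> real" where
  "ellipticK p q r =
     integral {0..1}
       (\<lambda>t. 1 / ((1 - t powr q) powr (1 / p) * (1 - r powr q * t powr q) powr (1 - 1 / p)))"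

definition ellipticE :: "real \<Rightarrow> real \<Rightarrow> real \<Rightarrow> real" where
  "ellipticE p q r =
     integral {0..1} (\<lambda>t. ((1 - r powr q * t powr q) / (1 - t powr q)) powr (1 / p))"

end

theory Submission imports Defs begin

text \<open>
  Both integrals belong to the family \<open>J\<^sub>s(r) = \<integral>\<^sub>0\<^sup>1 (1 - t\<^sup>q)\<^sup>-\<^sup>a (1 - r\<^sup>q t\<^sup>q)\<^sup>s dt\<close> with
  \<open>a = 1/p\<close>: \<open>E = J\<^sub>a\<close> and \<open>K = J\<^sub>a\<^sub>-\<^sub>1\<close>.  Since \<open>(1 - t\<^sup>q)\<^sup>-\<^sup>a \<le> (1 - t)\<^sup>-\<^sup>a\<close> is integrable, dominated
  convergence allows differentiation under the integral, and \<open>r\<^sup>q t\<^sup>q = 1 - (1 - r\<^sup>q t\<^sup>q)\<close> gives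
  \<open>J\<^sub>s' = (q s / r) (J\<^sub>s - J\<^sub>s\<^sub>-\<^sub>1)\<close>.  This settles \<open>E'\<close>; in \<open>K'\<close> the integral \<open>J\<^sub>a\<^sub>-\<^sub>2\<close> is eliminated by
  an integration by parts.  The second derivatives follow by differentiating these formulas.
\<close>

section \<open>Differentiation under the integral sign\<close>

text \<open>On the convex set \<open>T\<close> the mean value inequality turns the bound on
  \<open>f'\<close> into the bound \<open>g\<close> on every difference quotient. Dominated
  convergence then applies along each sequence in \<open>T - {x}\<close> tending to
  \<open>x\<close>, and openness of \<open>T\<close> makes the limit within \<open>T\<close> a full
  derivative.\<close>

lemma has_real_derivative_integral_dominated:
  fixes f f' :: "real \<Rightarrow> 'a::euclidean_space \<Rightarrow> real"
  assumes T: "open T" "convex T" "x \<in> T"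
    and int: "\<And>y. y \<in> T \<Longrightarrow> f y integrable_on S"
    and deriv: "\<And>y t. y \<in> T \<Longrightarrow> t \<in> S \<Longrightarrow> ((\<lambda>y. f y t) has_real_derivative f' y t) (at y)"
    and bound: "\<And>y t. y \<in> T \<Longrightarrow> t \<in> S \<Longrightarrow> \<bar>f' y t\<bar> \<le> g t"
    and g: "g integrable_on S"
  shows "((\<lambda>y. integral S (f y)) has_real_derivative integral S (f' x)) (at x)"
proof -
  have "((\<lambda>y. (integral S (f y) - integral S (f x)) / (y - x)) \<longlongrightarrow> integral S (f' x)) (at x within T)"
    unfolding tendsto_at_iff_sequentially
  proof (intro allI impI)
    fix X :: "nat \<Rightarrow> real"
    assume X: "\<forall>i. X i \<in> T - {x}" and lim: "X \<longlonglongrightarrow> x"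
    let ?h = "\<lambda>k t. (f (X k) t - f x t) / (X k - x)"
    have integ: "?h k integrable_on S" for k
      using X T int by (intro integrable_on_divide integrable_diff) auto
    have le: "norm (?h k t) \<le> g t" if "t \<in> S" for k t
    proof -
      have "norm (f (X k) t - f x t) \<le> g t * norm (X k - x)"
        using T X that deriv bound
        by (intro field_differentiable_bound[where S = T and f' = "\<lambda>y. f' y t"])
           (auto intro: has_field_derivative_at_within)
      moreover have "norm (X k - x) > 0"
        using X by auto
      ultimately show ?thesis
        by (simp add: norm_divide pos_divide_le_eq)
    qed
    have conv: "(\<lambda>k. ?h k t) \<longlonglongrightarrow> f' x t" if "t \<in> S" for t
    proof -
      have "((\<lambda>y. (f y t - f x t) / (y - x)) \<longlongrightarrow> f' x t) (at x)"
        using deriv[OF T(3) that] by (simp add: has_field_derivative_iff)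
      then show ?thesis
        using X lim unfolding tendsto_at_iff_sequentially comp_def by blast
    qed
    have "(\<lambda>k. integral S (?h k)) \<longlonglongrightarrow> integral S (f' x)"
      using dominated_convergence(2)[OF integ g le conv] .
    moreover have "integral S (?h k) = (integral S (f (X k)) - integral S (f x)) / (X k - x)" for k
      using X T int by (simp add: integral_diff)
    ultimately show "((\<lambda>y. (integral S (f y) - integral S (f x)) / (y - x)) \<circ> X) \<longlonglongrightarrow> integral S (f' x)"
      by (simp only: comp_def)
  qed
  then show ?thesis
    using at_within_open[OF T(3,1)] by (simp only: has_field_derivative_iff)
qed

text \<open>The maximum over \<open>[m, 1]\<close> is at \<open>1\<close> or at \<open>m\<close>
  according to the sign of \<open>e\<close>; adding both values gives one bound for exponents of
  unknown sign.\<close>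

lemma powr_le_one_plus_powr:
  fixes m z e :: real
  assumes "0 < m" "m \<le> z" "z \<le> 1"
  shows "z powr e \<le> 1 + m powr e"
proof (cases "e \<ge> 0")
  case True
  then have "z powr e \<le> 1"
    using assms powr_mono2[of e z 1] by simp
  then show ?thesis
    by (simp add: add_increasing2)
next
  case False
  then have "z powr e \<le> m powr e"
    using assms by (intro powr_mono2') auto
  then show ?thesis
    by simp
qed

section \<open>The family J_s and its integrability\<close>

text \<open>For 0 < a < 1, substituting u = t^q gives Euler's integral: up to a Beta factor this is
  the hypergeometric function 2F1(-s, 1/q; 1/q + 1 - a; r^q).\<close>

definition ellipticJ :: "real \<Rightarrow> real \<Rightarrow> real \<Rightarrow> real \<Rightarrow> real" where
  "ellipticJ a q s r = integral {0..1} (\<lambda>t. (1 - t powr q) powr (-a) * (1 - r powr q * t powr q) powr s)"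

lemma powr_mult_powr_bounds:
  fixes q r t :: real
  assumes "q > 1" "0 < r" "r < 1" "t \<in> {0..1}"
  shows "t powr q \<le> 1" "r powr q < 1" "0 \<le> r powr q * t powr q" "r powr q * t powr q \<le> r powr q"
proof -
  show t: "t powr q \<le> 1"
    using assms powr_mono2[of q t 1] by simp
  show "r powr q < 1"
    using assms powr_less_mono2[of q r 1] by simp
  show "0 \<le> r powr q * t powr q" by simp
  show "r powr q * t powr q \<le> r powr q"
    using t by (simp add: mult_left_le)
qed

lemma weighted_integrable:
  fixes a q C :: real
  assumes a: "0 < a" "a < 1" and q: "q > 1"
    and h: "h \<in> borel_measurable borel"
    and C: "\<And>t. t \<in> {0..1} \<Longrightarrow> \<bar>h t\<bar> \<le> C"
  shows "(\<lambda>t. (1 - t powr q) powr (-a) * h t) integrable_on {0..1}"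
proof -
  have "((\<lambda>t. (1 - t) powr (-a)) has_integral
          - ((1 - 1) powr (1 - a) / (1 - a)) - (- ((1 - 0) powr (1 - a) / (1 - a)))) {0..1::real}"
  \<comment> \<open>The integrand is unbounded near \<open>t = 1\<close>, but since
    \<open>a < 1\<close> the antiderivative is continuous on the closed interval, so
    differentiability inside suffices.\<close>
  proof (rule fundamental_theorem_of_calculus_interior)
    show "continuous_on {0..1} (\<lambda>t::real. - ((1 - t) powr (1 - a) / (1 - a)))"
      using a by (intro continuous_intros continuous_on_powr') auto
    fix t :: real assume "t \<in> {0<..<1}"
    then show "((\<lambda>t. - ((1 - t) powr (1 - a) / (1 - a))) has_vector_derivative (1 - t) powr (-a)) (at t)"
      using a unfolding has_real_derivative_iff_has_vector_derivative [symmetric]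
      by (auto intro!: derivative_eq_intros)
  qed simp
  then have "(\<lambda>t::real. (1 - t) powr (-a)) integrable_on {0..1}"
    by (rule has_integral_integrable)
  then have g: "(\<lambda>t::real. (1 - t) powr (-a) * C) integrable_on {0..1}"
    by (rule integrable_on_mult_left)
  have "(\<lambda>t. (1 - t powr q) powr (-a) * h t) \<in> borel_measurable borel"
    using h by measurable
  then have "(\<lambda>t. (1 - t powr q) powr (-a) * h t) \<in> borel_measurable (lebesgue_on {0..1})"
    by (intro measurable_restrict_space1 measurable_completion) simp
  then show ?thesis
  proof (rule measurable_bounded_by_integrable_imp_integrable[OF _ g])
    fix t :: real assume t: "t \<in> {0..1}"
    have "(1 - t powr q) powr (-a) \<le> (1 - t) powr (-a)"
    \<comment> \<open>At \<open>t = 1\<close> both sides are \<open>0 powr (-a) = 0\<close>;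
      elsewhere the bases are positive and the negative exponent reverses their order.\<close>
    proof (cases "t = 1")
      case False
      have "t powr q \<le> t"
        using t q powr_mono'[of 1 q t] by simp
      then show ?thesis
        using t False a by (intro powr_mono2') auto
    qed simp
    then show "norm ((1 - t powr q) powr (-a) * h t) \<le> (1 - t) powr (-a) * C"
      using C[OF t] by (simp add: abs_mult mult_mono)
  qed simp
qed

lemma ellipticJ_integrable:
  fixes a q r s :: real
  assumes "0 < a" "a < 1" "q > 1" "0 < r" "r < 1"
  shows "(\<lambda>t. (1 - t powr q) powr (-a) * (1 - r powr q * t powr q) powr s) integrable_on {0..1}"
proof (rule weighted_integrable)
  show "(\<lambda>t. (1 - r powr q * t powr q) powr s) \<in> borel_measurable borel"
    by measurable
  fix t :: real assume "t \<in> {0..1}"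
  \<comment> \<open>The base stays in \<open>[1 - r powr q, 1]\<close>, away from 0, so the only
    singularity is that of the weight.\<close>
  with assms have "(1 - r powr q * t powr q) powr s \<le> 1 + (1 - r powr q) powr s"
    using powr_mult_powr_bounds[of q r t] by (intro powr_le_one_plus_powr) auto
  then show "\<bar>(1 - r powr q * t powr q) powr s\<bar> \<le> 1 + (1 - r powr q) powr s"
    by simp
qed (use assms in auto)

text \<open>Both the derivative formula and the integration by parts reduce to recognising an
  integrand of this two-term shape.\<close>

lemma ellipticJ_integrals:
  fixes a q r s s' b c :: real
  assumes "0 < a" "a < 1" "q > 1" "0 < r" "r < 1"
  shows "((\<lambda>t. (1 - t powr q) powr (-a) *
            (b * (1 - r powr q * t powr q) powr s + c * (1 - r powr q * t powr q) powr s'))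
          has_integral b * ellipticJ a q s r + c * ellipticJ a q s' r) {0..1}"
proof -
  have "((\<lambda>t. (1 - t powr q) powr (-a) * (1 - r powr q * t powr q) powr s) has_integral ellipticJ a q s r) {0..1}" for s
    unfolding ellipticJ_def using ellipticJ_integrable[OF assms] by (rule integrable_integral)
  from has_integral_add[OF has_integral_mult_right[OF this] has_integral_mult_right[OF this]]
  show ?thesis
    by (rule has_integral_eq_rhs[OF has_integral_eq, rotated]) (auto simp: algebra_simps)
qed

section \<open>Derivative of J_s and the contiguous relation\<close>

lemma has_derivative_ellipticJ:
  fixes a q r s :: real
  assumes "0 < a" "a < 1" "q > 1" "0 < r" "r < 1"
  shows "(ellipticJ a q s has_real_derivative q * s / r * (ellipticJ a q s r - ellipticJ a q (s - 1) r)) (at r)"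
proof -
  \<comment> \<open>Any \<open>d\<close> strictly between \<open>r\<close> and 1 would do: for
    \<open>y < d\<close> the base is at least \<open>1 - d powr q > 0\<close>, uniformly in
    \<open>y\<close> and \<open>t\<close>.\<close>
  define d where "d = (1 + r) / 2"
  have d: "r < d" "0 < d" "d < 1"
    using assms by (auto simp: d_def)
  have dq: "d powr q < 1"
    using d assms powr_mult_powr_bounds(2)[of q d 1] by simp
  let ?f = "\<lambda>y t. (1 - t powr q) powr (-a) * (1 - y powr q * t powr q) powr s"
  let ?f' = "\<lambda>y t. (1 - t powr q) powr (-a) *
               (s * (1 - y powr q * t powr q) powr (s - 1) * (- (q * y powr (q - 1) * t powr q)))"
  \<comment> \<open>The factors bound in turn \<open>s\<close>, the power with exponent
    \<open>s - 1\<close>, and the inner derivative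
    \<open>q * y powr (q - 1) * t powr q\<close>.\<close>
  define C where "C = \<bar>s\<bar> * (1 + (1 - d powr q) powr (s - 1)) * q"
  have "((\<lambda>y. integral {0..1} (?f y)) has_real_derivative integral {0..1} (?f' r)) (at r)"
  proof (rule has_real_derivative_integral_dominated[where T = "{0<..<d}"])
    show "(\<lambda>t. (1 - t powr q) powr (-a) * C) integrable_on {0..1}"
      using assms by (intro weighted_integrable[where C = "\<bar>C\<bar>"]) auto
    fix y assume y: "y \<in> {0<..<d}"
    then have y1: "0 < y" "y < 1"
      using d by auto
    show "?f y integrable_on {0..1}"
      using ellipticJ_integrable[of a q y s] assms y1 by simp
    fix t :: real assume t: "t \<in> {0..1}"
    note m = powr_mult_powr_bounds[OF assms(3) y1 t]
    have pos: "1 - y powr q * t powr q > 0"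
      using m by linarith
    show "((\<lambda>y. ?f y t) has_real_derivative ?f' y t) (at y)"
      using pos y1 by (auto intro!: derivative_eq_intros)
    have "y powr q \<le> d powr q"
      using y assms by (intro powr_mono2) auto
    then have 1: "(1 - y powr q * t powr q) powr (s - 1) \<le> 1 + (1 - d powr q) powr (s - 1)"
      using m dq by (intro powr_le_one_plus_powr) auto
    have "y powr (q - 1) * t powr q \<le> 1 * 1"
      using y1 assms m powr_mono2[of "q - 1" y 1] by (intro mult_mono) auto
    then have 2: "q * y powr (q - 1) * t powr q \<le> q"
      using assms by (simp add: mult.assoc)
    have "\<bar>s * (1 - y powr q * t powr q) powr (s - 1) * (- (q * y powr (q - 1) * t powr q))\<bar>
        = \<bar>s\<bar> * (1 - y powr q * t powr q) powr (s - 1) * (q * y powr (q - 1) * t powr q)"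
      using assms by (simp add: abs_mult)
    also have "\<dots> \<le> C"
      unfolding C_def using 1 2 assms by (intro mult_mono) auto
    finally show "\<bar>?f' y t\<bar> \<le> (1 - t powr q) powr (-a) * C"
      unfolding abs_mult[of "(1 - t powr q) powr (-a)"] by (simp add: mult_left_mono)
  qed (use assms d in auto)
  moreover have "(?f' r has_integral q * s / r * ellipticJ a q s r + - (q * s / r) * ellipticJ a q (s - 1) r) {0..1}"
  proof (rule has_integral_eq[OF _ ellipticJ_integrals[OF assms]])
    fix t :: real assume t: "t \<in> {0..1}"
    define z where "z = 1 - r powr q * t powr q"
    have "z > 0"
      using powr_mult_powr_bounds[OF assms(3-5) t] by (simp add: z_def)
    then have z: "z powr s = z * z powr (s - 1)"
      using powr_add[of z 1 "s - 1"] by simp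
    have "r powr q = r * r powr (q - 1)"
      using assms powr_add[of r 1 "q - 1"] by simp
    then have rt: "r powr (q - 1) * t powr q = (1 - z) / r"
      using assms by (simp add: z_def field_simps)
    have "q * s / r * z powr s + - (q * s / r) * z powr (s - 1)
        = s * z powr (s - 1) * - (q * (r powr (q - 1) * t powr q))"
      unfolding z rt using assms by (simp add: field_simps)
    then show "(1 - t powr q) powr - a * (q * s / r * (1 - r powr q * t powr q) powr s +
           - (q * s / r) * (1 - r powr q * t powr q) powr (s - 1)) = ?f' r t"
      by (simp add: z_def mult.assoc)
  qed
  then have "integral {0..1} (?f' r) = q * s / r * ellipticJ a q s r + - (q * s / r) * ellipticJ a q (s - 1) r"
    by (rule integral_unique)
  then have "integral {0..1} (?f' r) = q * s / r * (ellipticJ a q s r - ellipticJ a q (s - 1) r)"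
    by (rule trans) (simp add: right_diff_distrib)
  moreover have "ellipticJ a q s = (\<lambda>y. integral {0..1} (?f y))"
    by (simp add: ellipticJ_def fun_eq_iff)
  ultimately show ?thesis
    by (simp only:)
qed

text \<open>Integrating the derivative of \<open>t (1 - t\<^sup>q)\<^sup>1\<^sup>-\<^sup>a (1 - r\<^sup>q t\<^sup>q)\<^sup>a\<^sup>-\<^sup>1\<close>, which vanishes at both endpoints.\<close>

lemma ellipticJ_contiguous:
  fixes a q r :: real
  assumes "0 < a" "a < 1" "q > 1" "0 < r" "r < 1"
  shows "ellipticJ a q a r - (1 - r powr q) * ellipticJ a q (a - 1) r
       = (1 - a) * q * (1 - r powr q) * (ellipticJ a q (a - 2) r - ellipticJ a q (a - 1) r)"
proof -
  define R where "R = r powr q"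
  let ?F = "\<lambda>t. t * (1 - t powr q) powr (1 - a) * (1 - R * t powr q) powr (a - 1)"
  let ?k = "(1 - a) * q * (1 - R)"
  let ?g = "\<lambda>t. (1 - t powr q) powr (-a) * (1 * (1 - R * t powr q) powr a + (- (1 - R)) * (1 - R * t powr q) powr (a - 1))
      - (1 - t powr q) powr (-a) * (?k * (1 - R * t powr q) powr (a - 2) + (- ?k) * (1 - R * t powr q) powr (a - 1))"
  have pos: "1 - R * t powr q > 0" if "t \<in> {0..1}" for t
    using powr_mult_powr_bounds[OF assms(3-5) that] unfolding R_def by linarith
  \<comment> \<open>The factor \<open>R\<close> avoids division: with z = 1 - R t^q, one has R t^q =
    1 - z and R (1 - t^q) = z - (1 - R), so the derivative of \<open>R * ?F\<close> contains t only
    through the weight and powers of z.\<close>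
  have "(?g has_integral R * ?F 1 - R * ?F 0) {0..1}"
  proof (rule fundamental_theorem_of_calculus_interior)
    show "continuous_on {0..1} (\<lambda>t. R * ?F t)"
      using assms pos powr_mult_powr_bounds(1)[OF assms(3-5)]
      by (intro continuous_intros continuous_on_powr') (auto simp: less_imp_neq[symmetric] less_imp_le)
    fix t :: real assume t: "t \<in> {0<..<1}"
    define v where "v = t powr q"
    have v: "v < 1" "0 < v"
      using t assms powr_less_mono2[of q t 1] by (auto simp: v_def)
    have z: "1 - R * v > 0"
      using pos[of t] t by (simp add: v_def)
    have vt: "t powr (q - 1) * t = v"
      using t powr_add[of t "q - 1" 1] by (simp add: v_def)
    define A where "A = (1 - v) powr (-a)"
    \<comment> \<open>The lowest powers occurring are \<open>A\<close> and \<open>B\<close>; once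
      they are factored out, only a polynomial identity in \<open>v\<close> and \<open>R\<close>
      remains.\<close>
    define B where "B = (1 - R * v) powr (a - 2)"
    have A: "(1 - v) powr (1 - a) = (1 - v) * A"
      using v powr_add[of "1 - v" 1 "-a"] by (simp add: A_def)
    have B1: "(1 - R * v) powr (a - 1) = (1 - R * v) * B"
      using z powr_add[of "1 - R * v" 1 "a - 2"] by (simp add: B_def)
    have B2: "(1 - R * v) powr a = (1 - R * v) * ((1 - R * v) * B)"
      using z powr_add[of "1 - R * v" 1 "a - 1"] by (simp add: B1)
    have "(?F has_real_derivative
        (1 - v) powr (1 - a) * (1 - R * v) powr (a - 1)
        - t * ((1 - a) * (1 - v) powr (-a) * (q * t powr (q - 1))) * (1 - R * v) powr (a - 1)
        - t * (1 - v) powr (1 - a) * ((a - 1) * (1 - R * v) powr (a - 2) * (R * (q * t powr (q - 1))))) (at t)"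
      using t v z unfolding v_def
      by (auto intro!: derivative_eq_intros simp: algebra_simps)
    also have "(1 - v) powr (1 - a) * (1 - R * v) powr (a - 1)
        - t * ((1 - a) * (1 - v) powr (-a) * (q * t powr (q - 1))) * (1 - R * v) powr (a - 1)
        - t * (1 - v) powr (1 - a) * ((a - 1) * (1 - R * v) powr (a - 2) * (R * (q * t powr (q - 1))))
      = A * B * ((1 - v) * (1 - R * v) - (1 - a) * q * (t powr (q - 1) * t) * (1 - R * v)
         + (1 - a) * q * R * (t powr (q - 1) * t) * (1 - v))"
      unfolding A B1 A_def[symmetric] B_def[symmetric] by (simp add: algebra_simps)
    finally have "((\<lambda>t. R * ?F t) has_real_derivative R * (A * B * ((1 - v) * (1 - R * v) - (1 - a) * q * v * (1 - R * v)
         + (1 - a) * q * R * v * (1 - v)))) (at t)"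
      unfolding vt by (rule DERIV_cmult)
    also have "R * (A * B * ((1 - v) * (1 - R * v) - (1 - a) * q * v * (1 - R * v)
         + (1 - a) * q * R * v * (1 - v))) = ?g t"
      unfolding v_def[symmetric] B2 B1 A_def[symmetric] B_def[symmetric] by (simp add: algebra_simps)
    finally show "((\<lambda>t. R * ?F t) has_vector_derivative ?g t) (at t)"
      by (simp only: has_real_derivative_iff_has_vector_derivative)
  qed simp
  moreover have "(?g has_integral (1 * ellipticJ a q a r + (- (1 - R)) * ellipticJ a q (a - 1) r)
      - (?k * ellipticJ a q (a - 2) r + (- ?k) * ellipticJ a q (a - 1) r)) {0..1}"
    unfolding R_def by (intro has_integral_diff ellipticJ_integrals assms)
  ultimately have "R * ?F 1 - R * ?F 0 = (1 * ellipticJ a q a r + (- (1 - R)) * ellipticJ a q (a - 1) r)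
      - (?k * ellipticJ a q (a - 2) r + (- ?k) * ellipticJ a q (a - 1) r)"
    by (rule has_integral_unique)
  moreover have "?F 0 = 0" "?F 1 = 0"
    by simp_all
  ultimately have "ellipticJ a q a r - (1 - R) * ellipticJ a q (a - 1) r = ?k * (ellipticJ a q (a - 2) r - ellipticJ a q (a - 1) r)"
    by (simp only:) (simp add: algebra_simps)
  then show ?thesis
    by (simp only: R_def)
qed

section \<open>First derivatives of K and E\<close>

lemma ellipticK_eq_ellipticJ:
  assumes "q > 1" "0 < r" "r < 1"
  shows "ellipticK p q r = ellipticJ (1 / p) q (1 / p - 1) r"
  unfolding ellipticK_def ellipticJ_def
proof (rule integral_cong)
  fix t :: real
  have "(1 - r powr q * t powr q) powr (1 / p - 1) = 1 / (1 - r powr q * t powr q) powr (1 - 1 / p)"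
    using powr_minus_divide[of "1 - r powr q * t powr q" "1 - 1 / p"] by simp
  then show "1 / ((1 - t powr q) powr (1 / p) * (1 - r powr q * t powr q) powr (1 - 1 / p)) =
      (1 - t powr q) powr - (1 / p) * (1 - r powr q * t powr q) powr (1 / p - 1)"
    by (simp add: powr_minus_divide)
qed

lemma ellipticE_eq_ellipticJ:
  assumes "q > 1" "0 < r" "r < 1"
  shows "ellipticE p q r = ellipticJ (1 / p) q (1 / p) r"
  unfolding ellipticE_def ellipticJ_def
proof (rule integral_cong)
  fix t :: real assume t: "t \<in> {0..1}"
  show "((1 - r powr q * t powr q) / (1 - t powr q)) powr (1 / p) =
      (1 - t powr q) powr - (1 / p) * (1 - r powr q * t powr q) powr (1 / p)"
    \<comment> \<open>The equality includes \<open>t = 1\<close>: there division by zero and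
      \<open>0 powr _\<close> make both sides 0.\<close>
    using powr_mult_powr_bounds[OF assms t] by (simp add: powr_divide powr_minus_divide)
qed

lemma has_derivative_ellipticE:
  fixes p q r :: real
  assumes "p > 1" "q > 1" "0 < r" "r < 1"
  shows "(ellipticE p q has_real_derivative q / (p * r) * (ellipticE p q r - ellipticK p q r)) (at r)"
\<comment> \<open>The identification of E with J is established only on (0,1), an open neighbourhood
  of \<open>r\<close>, which is enough to transfer the derivative.\<close>
proof (rule has_field_derivative_transform_within_open)
  show "(ellipticJ (1 / p) q (1 / p) has_real_derivative q / (p * r) * (ellipticE p q r - ellipticK p q r)) (at r)"
    using has_derivative_ellipticJ[of "1 / p" q r "1 / p"] assms by (simp add: ellipticE_eq_ellipticJ ellipticK_eq_ellipticJ)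
  show "open {0<..<1::real}" "r \<in> {0<..<1}"
    using assms by auto
  show "ellipticJ (1 / p) q (1 / p) x = ellipticE p q x" if "x \<in> {0<..<1}" for x
    using that assms(2) by (simp add: ellipticE_eq_ellipticJ)
qed

lemma has_derivative_ellipticK:
  fixes p q r :: real
  assumes "p > 1" "q > 1" "0 < r" "r < 1"
  shows "(ellipticK p q has_real_derivative
    (ellipticE p q r - (1 - r powr q) * ellipticK p q r) / (r * (1 - r powr q))) (at r)"
proof (rule has_field_derivative_transform_within_open)
  let ?a = "1 / p"
  have a: "0 < ?a" "?a < 1"
    using assms by auto
  have w: "1 - r powr q > 0"
    using powr_mult_powr_bounds(2)[of q r 1] assms by simp
  have "q * (?a - 1) / r * (ellipticJ ?a q (?a - 1) r - ellipticJ ?a q (?a - 1 - 1) r)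
      = (ellipticJ ?a q ?a r - (1 - r powr q) * ellipticJ ?a q (?a - 1) r) / (r * (1 - r powr q))"
    \<comment> \<open>The relation rewrites the numerator on the right as a multiple of J_(a-2) -
      J_(a-1); its factor \<open>1 - r powr q\<close> cancels against the denominator.\<close>
    unfolding ellipticJ_contiguous[OF a assms(2-4)] using w assms by (simp add: field_simps)
  then show "(ellipticJ ?a q (?a - 1) has_real_derivative
      (ellipticE p q r - (1 - r powr q) * ellipticK p q r) / (r * (1 - r powr q))) (at r)"
    using has_derivative_ellipticJ[OF a assms(2-4), of "?a - 1"] assms
    by (simp add: ellipticE_eq_ellipticJ ellipticK_eq_ellipticJ)
  show "open {0<..<1::real}" "r \<in> {0<..<1}"
    using assms by auto
  show "ellipticJ (1 / p) q (1 / p - 1) x = ellipticK p q x" if "x \<in> {0<..<1}" for x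
    using that assms(2) by (simp add: ellipticK_eq_ellipticJ)
qed

section \<open>Second derivatives of K and E\<close>

theorem theorem2p1:
  fixes p q r r' :: real
  assumes "p > 1" and "q > 1" and "0 < r" and "r < 1"
    and "r' = (1 - r powr q) powr (1 / q)"
  shows "(ellipticK p q has_real_derivative
            1 / (r * r' powr q) * (ellipticE p q r - r' powr q * ellipticK p q r)) (at r)
    \<and> (ellipticE p q has_real_derivative
            q / (p * r) * (ellipticE p q r - ellipticK p q r)) (at r)
    \<and> (deriv (ellipticK p q) has_real_derivative
            1 / (r\<^sup>2 * r' powr (2 * q)) *
              ((q * r' powr q / p + q * r powr q - 2 * r' powr q) * ellipticE p q r
               + (2 * r' powr (2 * q) - q / p * r' powr q) * ellipticK p q r)) (at r)
    \<and> (deriv (ellipticE p q) has_real_derivative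
            q / (p * r\<^sup>2) *
              ((q / p - 1 / r' powr q - 1) * ellipticE p q r
               + (2 - q / p) * ellipticK p q r)) (at r)"
proof -
  \<comment> \<open>This is (r')^q, so every power of \<open>r'\<close> in the claim becomes a power
    of \<open>w\<close>.\<close>
  define w where "w = 1 - r powr q"
  have w: "w > 0"
    using powr_mult_powr_bounds(2)[of q r 1] assms by (simp add: w_def)
  have r': "r' powr q = w" "r' powr (2 * q) = w * w"
    using assms w powr_add[of w 1 1] by (simp_all add: powr_powr w_def)
  have rq: "r * r powr (q - 1) = r powr q"
    using assms powr_add[of r 1 "q - 1"] by simp
  let ?E = "ellipticE p q r" and ?K = "ellipticK p q r"
  note dE = has_derivative_ellipticE[OF assms(1,2)] and dK = has_derivative_ellipticK[OF assms(1,2)]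
  note dEr = dE[OF assms(3,4)] and dKr = dK[OF assms(3,4), folded w_def]
  have dw: "((\<lambda>x. 1 - x powr q) has_real_derivative - (q * r powr (q - 1))) (at r)"
    using assms by (auto intro!: derivative_eq_intros)
  have "(deriv (ellipticK p q) has_real_derivative
            1 / (r\<^sup>2 * (w * w)) *
              ((q * w / p + q * r powr q - 2 * w) * ?E + (2 * (w * w) - q / p * w) * ?K)) (at r)"
  \<comment> \<open>The first-derivative formula equals \<open>deriv (ellipticK p q)\<close>
    throughout (0,1), so differentiating the formula at \<open>r\<close> yields the second
    derivative.\<close>
  proof (rule has_field_derivative_transform_within_open)
    \<comment> \<open>\<open>D\<close> is the derivative at \<open>r\<close> of the numerator E - (1
      - x^q) K, with E' and K' already inserted.\<close>
    define D where "D = q / (p * r) * (?E - ?K) -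
        (- (q * r powr (q - 1)) * ?K + (?E - w * ?K) / (r * w) * w)"
    have "((\<lambda>x. (ellipticE p q x - (1 - x powr q) * ellipticK p q x) / (x * (1 - x powr q)))
        has_real_derivative (D * (r * w) - (?E - w * ?K) * (1 * w + - (q * r powr (q - 1)) * r))
          / ((r * w) * (r * w))) (at r)"
      unfolding D_def w_def using w assms(3)
      by (intro DERIV_divide DERIV_diff DERIV_mult dEr dKr[unfolded w_def] dw DERIV_ident) (auto simp: w_def)
    also have "(D * (r * w) - (?E - w * ?K) * (1 * w + - (q * r powr (q - 1)) * r)) / ((r * w) * (r * w)) =
        1 / (r\<^sup>2 * (w * w)) *
          ((q * w / p + q * r powr q - 2 * w) * ?E + (2 * (w * w) - q / p * w) * ?K)"
    proof -
      have "D * r = q / p * (?E - ?K) + q * r powr q * ?K - (?E - w * ?K)"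
        using w assms(1,3) unfolding D_def rq[symmetric] by (simp add: field_simps)
      then have "D * (r * w) = (q / p * (?E - ?K) + q * r powr q * ?K - (?E - w * ?K)) * w"
        by (simp only: mult.assoc[symmetric])
      moreover have "- (q * r powr (q - 1)) * r = - (q * r powr q)"
        unfolding rq[symmetric] by simp
      \<comment> \<open>With the denominators cleared this is linear in E and K; the two terms in q
        r^q w K cancel.\<close>
      ultimately have "D * (r * w) - (?E - w * ?K) * (1 * w + - (q * r powr (q - 1)) * r) =
          (q * w / p + q * r powr q - 2 * w) * ?E + (2 * (w * w) - q / p * w) * ?K"
        by (simp only:) (simp add: algebra_simps add_divide_distrib diff_divide_distrib)
      then show ?thesis
        by (simp only:) (simp add: power2_eq_square mult_ac)
    qed
    finally show "((\<lambda>x. (ellipticE p q x - (1 - x powr q) * ellipticK p q x) / (x * (1 - x powr q)))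
        has_real_derivative \<dots>) (at r)" .
    show "open {0<..<1::real}" "r \<in> {0<..<1}"
      using assms(3,4) by auto
    show "(ellipticE p q x - (1 - x powr q) * ellipticK p q x) / (x * (1 - x powr q)) = deriv (ellipticK p q) x"
      if "x \<in> {0<..<1}" for x
      using that DERIV_imp_deriv[OF dK, of x] by simp
  qed
  moreover have "(deriv (ellipticE p q) has_real_derivative
            q / (p * r\<^sup>2) * ((q / p - 1 / w - 1) * ?E + (2 - q / p) * ?K)) (at r)"
  proof (rule has_field_derivative_transform_within_open)
    \<comment> \<open>The constant q/p is split off from E', leaving only the quotient (E - K)/x to
      differentiate.\<close>
    have "((\<lambda>x. q / p * ((ellipticE p q x - ellipticK p q x) / x)) has_real_derivative
        q / p * (((q / (p * r) * (?E - ?K) - (?E - w * ?K) / (r * w)) * r - (?E - ?K) * 1) / (r * r))) (at r)"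
      using assms(3) by (intro DERIV_cmult DERIV_divide DERIV_diff dEr dKr DERIV_ident) auto
    also have "q / p * (((q / (p * r) * (?E - ?K) - (?E - w * ?K) / (r * w)) * r - (?E - ?K) * 1) / (r * r))
        = q / (p * r\<^sup>2) * ((q / p - 1 / w - 1) * ?E + (2 - q / p) * ?K)"
      using assms(1,3) w by (simp add: field_simps power2_eq_square)
    finally show "((\<lambda>x. q / p * ((ellipticE p q x - ellipticK p q x) / x)) has_real_derivative \<dots>) (at r)" .
    show "open {0<..<1::real}" "r \<in> {0<..<1}"
      using assms(3,4) by auto
    show "q / p * ((ellipticE p q x - ellipticK p q x) / x) = deriv (ellipticE p q) x"
      if "x \<in> {0<..<1}" for x
      using that DERIV_imp_deriv[OF dE, of x] by simp
  qed
  ultimately show ?thesis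
    unfolding r' using dEr dKr by simp
qed

end
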